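(* Let $d\ge1$ and fix an enumeration $(N_j)_{j\ge 0}$ of $\mathbb{N}^d$. Let $V\subseteq\mathbb{C}^d$ be open, let $f:V\to\mathbb{C}$ be holomorphic, and let $\zeta\in\overline V$ be a point such that for every differential operator $D$ of mixed partial derivatives, $Df$ extends continuously to the point $\zeta$. Then the set $U(f,\zeta)$ of $\zeta$-universal points with respect to $f$ is a $G_\delta$ subset of $\mathbb{C}^d$.
   Context: A differential operator of mixed partial derivatives is $D=\partial^{a_1+\dots+a_d}/\partial z_1^{a_1}\cdots\partial z_d^{a_d}$ with $a\in\mathbb{N}^d$, $\mathbb{N}=\{0,1,2,\dots\}$. The partial sums are $S_n(f,\zeta)(z)=\sum_{j=0}^n a_{N_j}(f,\zeta)(z-\zeta)^{N_j}$, where $(z-\zeta)^a=\prod_i(z_i-\zeta_i)^{a_i}$ and, for $a=N_j=(a_1,\dots,a_d)$, $a_{N_j}(f,\zeta)=\frac{1}{a_1!\cdots a_d!}\frac{\partial^{a_1+\dots+a_d}f}{\partial z_1^{a_1}\cdots\partial z_d^{a_d}}(\zeta)$ (the value of the continuous extension if $\zeta\notin V$). A point $z\in\mathbb{C}^d$ is called $\zeta$-universal with respect to $f$ if the set of partial sums $\{S_n(f,\zeta)(z):n\ge 0\}$ is dense in $\mathbb{C}$. $U(f,\zeta)$ is the set of all $\zeta$-universal points with respect to $f$. *)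

theory Defs
  imports "HOL-Analysis.Analysis"
begin

text \<open>
  \<open>complex ^ 'd\<close> is $C^d$ with $d = $ \<open>CARD('d)\<close>; the linear order on the index type fixes
  which coordinate is the first, the second, and so on.
  Multi-indices are functions \<open>'d \<Rightarrow> nat\<close>.
\<close>

text \<open>
  Holomorphy in several variables: Frechet differentiability with complex-linear derivative
  (\<open>has_derivative\<close> alone gives only a real-linear one).
\<close>

definition holomorphic_multi :: "(complex ^ 'd \<Rightarrow> complex) \<Rightarrow> (complex ^ 'd) set \<Rightarrow> bool" where
  "holomorphic_multi f V \<longleftrightarrow>
     (\<forall>z\<in>V. \<exists>L. (f has_derivative L) (at z) \<and> (\<forall>c v. L (c *s v) = c * L v))"

definition partial_deriv :: "'d \<Rightarrow> (complex ^ 'd \<Rightarrow> complex) \<Rightarrow> complex ^ 'd \<Rightarrow> complex" where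
  "partial_deriv i f z = deriv (\<lambda>t. f (z + axis i t)) 0"

text \<open>
  With coordinates \<open>i\<^sub>1 < \<dots> < i\<^sub>d\<close>, the operator applies \<open>\<partial>\<^bsub>i\<^sub>d\<^esub>\<close> first and \<open>\<partial>\<^bsub>i\<^sub>1\<^esub>\<close> last.
\<close>

definition mixed_partial ::
    "('d::{finite,linorder} \<Rightarrow> nat) \<Rightarrow> (complex ^ 'd::_ \<Rightarrow> complex) \<Rightarrow> complex ^ 'd::_ \<Rightarrow> complex" where
  "mixed_partial a f = foldr (\<lambda>i. partial_deriv i ^^ a i) (sorted_list_of_set UNIV) f"

definition extends_continuously_to ::
    "('a::topological_space \<Rightarrow> 'b::topological_space) \<Rightarrow> 'a set \<Rightarrow> 'a \<Rightarrow> bool" where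
  "extends_continuously_to g V \<zeta> \<longleftrightarrow>
     (\<exists>h. continuous_on (insert \<zeta> V) h \<and> (\<forall>z\<in>V. h z = g z))"

text \<open>
  Meaningful when \<open>extends_continuously_to g V \<zeta>\<close> and \<open>\<zeta> \<in> closure V\<close>; for \<open>\<zeta> \<notin> V\<close> the value of
  the (then unique) continuous extension is the limit along \<open>V\<close>.
\<close>

definition extended_value ::
    "('a::t2_space \<Rightarrow> 'b::t2_space) \<Rightarrow> 'a set \<Rightarrow> 'a \<Rightarrow> 'b" where
  "extended_value g V \<zeta> = (if \<zeta> \<in> V then g \<zeta> else Lim (at \<zeta> within V) g)"

definition taylor_coeff ::
    "(complex ^ 'd::_ \<Rightarrow> complex) \<Rightarrow> (complex ^ 'd::_) set \<Rightarrow> complex ^ 'd::_ \<Rightarrow>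
      ('d::{finite,linorder} \<Rightarrow> nat) \<Rightarrow> complex" where
  "taylor_coeff f V \<zeta> a = extended_value (mixed_partial a f) V \<zeta> / (\<Prod>i\<in>UNIV. fact (a i))"

definition multi_power :: "complex ^ 'd \<Rightarrow> ('d \<Rightarrow> nat) \<Rightarrow> complex" where
  "multi_power w a = (\<Prod>i\<in>UNIV. (w $ i) ^ a i)"

definition partial_sum ::
    "(nat \<Rightarrow> 'd::{finite,linorder} \<Rightarrow> nat) \<Rightarrow> (complex ^ 'd::_ \<Rightarrow> complex) \<Rightarrow> (complex ^ 'd::_) set \<Rightarrow>
      complex ^ 'd::_ \<Rightarrow> nat \<Rightarrow> complex ^ 'd::_ \<Rightarrow> complex" where
  "partial_sum N f V \<zeta> n z = (\<Sum>j\<le>n. taylor_coeff f V \<zeta> (N j) * multi_power (z - \<zeta>) (N j))"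

definition universal_points ::
    "(nat \<Rightarrow> 'd::{finite,linorder} \<Rightarrow> nat) \<Rightarrow> (complex ^ 'd::_ \<Rightarrow> complex) \<Rightarrow> (complex ^ 'd::_) set \<Rightarrow>
      complex ^ 'd::_ \<Rightarrow> (complex ^ 'd::_) set" where
  "universal_points N f V \<zeta> = {z. closure (range (\<lambda>n. partial_sum N f V \<zeta> n z)) = UNIV}"

end

theory Submission imports Defs begin

text \<open>Each partial sum is a polynomial in z, since the Taylor coefficients at \<zeta> are
  constants; hence it is continuous. As the complex plane has a countable basis, z is universal iff
  for every nonempty basic open W some partial sum at z lies in W. For fixed W such z form a union
  of preimages of W, an open set, so the universal points are a countable intersection of open sets.
  \<open>gdelta_dense_range\<close> carries this out for any sequence of continuous maps into a
  second countable space.\<close>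

text \<open>Turns density into one condition per basis element, so that a countable basis leaves
  only countably many conditions.\<close>

lemma closure_UNIV_iff_basis:
  assumes "topological_basis B"
  shows "closure T = UNIV \<longleftrightarrow> (\<forall>W\<in>B. W \<noteq> {} \<longrightarrow> W \<inter> T \<noteq> {})"
proof
  assume T: "closure T = UNIV"
  have "W \<inter> T \<noteq> {}" if "W \<in> B" "W \<noteq> {}" for W
    using that T open_Int_closure_eq_empty[of W T] topological_basis_open[OF assms] by auto
  then show "\<forall>W\<in>B. W \<noteq> {} \<longrightarrow> W \<inter> T \<noteq> {}" by blast
next
  assume meets: "\<forall>W\<in>B. W \<noteq> {} \<longrightarrow> W \<inter> T \<noteq> {}"
  have "w \<in> closure T" for w
  proof (rule ccontr)
    assume "w \<notin> closure T"
    then obtain W where "W \<in> B" "w \<in> W" "W \<subseteq> - closure T"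
      using topological_basisE[OF assms open_Compl[OF closed_closure]] by blast
    then show False using meets closure_subset[of T] by blast
  qed
  then show "closure T = UNIV" by blast
qed

lemma gdelta_dense_range:
  fixes S :: "nat \<Rightarrow> 'a::topological_space \<Rightarrow> 'b::second_countable_topology"
  assumes cont: "\<And>n. continuous_on UNIV (S n)"
  shows "gdelta {z. closure (range (\<lambda>n. S n z)) = UNIV}"
proof -
  obtain B :: "'b set set" where B: "countable B" "topological_basis B"
    using ex_countable_basis by blast
  have "B \<noteq> {}"
    using topological_basisE[OF B(2) open_UNIV] by blast
  \<comment> \<open>A basis may contain the empty set, whose condition is vacuous; without the case
    split it would contribute an empty union and make the whole intersection empty.\<close>
  define U where "U W = (if W = {} then UNIV else (\<Union>n. S n -` W))" for W
  have "open (U W)" if "W \<in> B" for W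
    using topological_basis_open[OF B(2) that] cont
    by (auto simp: U_def intro!: open_vimage)
  \<comment> \<open>\<open>gdelta.intros\<close> wants a sequence of open sets.
    \<open>from_nat_into\<close> lists the nonempty countable \<open>B\<close>, with repetitions if
    \<open>B\<close> is finite.\<close>
  then have "gdelta (\<Inter>n. U (from_nat_into B n))"
    by (intro gdelta.intros) (simp add: from_nat_into \<open>B \<noteq> {}\<close>)
  also have "(\<Inter>n. U (from_nat_into B n)) = (\<Inter>W\<in>range (from_nat_into B). U W)"
    by blast
  also have "\<dots> = (\<Inter>W\<in>B. U W)"
    by (simp only: range_from_nat_into[OF \<open>B \<noteq> {}\<close> B(1)])
  also have "\<dots> = {z. closure (range (\<lambda>n. S n z)) = UNIV}"
  proof -
    have "z \<in> U W \<longleftrightarrow> (W \<noteq> {} \<longrightarrow> W \<inter> range (\<lambda>n. S n z) \<noteq> {})" for z W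
      unfolding U_def by auto
    then show ?thesis
      unfolding closure_UNIV_iff_basis[OF B(2)]
      by (intro set_eqI) (simp only: INT_iff mem_Collect_eq)
  qed
  finally show ?thesis .
qed

lemma continuous_on_partial_sum: "continuous_on A (partial_sum N f V \<zeta> n)"
  unfolding partial_sum_def[abs_def] multi_power_def by (intro continuous_intros)

theorem theorem4p2:
  fixes N :: "nat \<Rightarrow> 'd::{finite,linorder} \<Rightarrow> nat"
    and V :: "(complex ^ 'd::_) set"
    and f :: "complex ^ 'd::_ \<Rightarrow> complex"
    and \<zeta> :: "complex ^ 'd::_"
  assumes "bij N"
    and "open V"
    and "holomorphic_multi f V"
    and "\<zeta> \<in> closure V"
    and "\<And>a. extends_continuously_to (mixed_partial a f) V \<zeta>"
  shows "gdelta (universal_points N f V \<zeta>)"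
  unfolding universal_points_def by (rule gdelta_dense_range[OF continuous_on_partial_sum])

end
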